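(* Let $m,n$ be positive integers and let $\sigma:[m]\to[n]$ be a random function such that $\sigma(1),\ldots,\sigma(m)$ are independent (not necessarily identically distributed) random variables with values in $[n]$. For $j\in[n]$ let $B_j:=|\sigma^{-1}(j)|$. Let $d\in\{0,1,\ldots,n-1\}$ and $\mathbf{a}=(a_1,\ldots,a_d)\in\mathbb{N}^d$, let $Q_{\mathbf{a}}:=\{B_1=a_1,\ldots,B_d=a_d\}$, assume $Q_{\mathbf{a}}$ has positive probability, and let $\nu_{\mathbf{a}}$ be the law of the random set $\sigma^{-1}(n)\subseteq[m]$ conditioned on $Q_{\mathbf{a}}$. Then $\nu_{\mathbf{a}}$ satisfies the normalized matching property (NMP).
   Context: Notation: $\mathbb{N}=\{0,1,2,\ldots\}$, $[m]=\{1,\ldots,m\}$, and $2^{[m]}$ is the set of subsets of $[m]$, ordered by inclusion. A family $\mathcal{A}\subseteq 2^{[m]}$ is increasing if $S\in\mathcal{A}$ and $S\subseteq T\subseteq[m]$ imply $T\in\mathcal{A}$. A probability measure $\nu$ on $2^{[m]}$ satisfies the normalized matching property (NMP) if, with $Z$ a random subset of $[m]$ sampled according to $\nu$, $$\nu(\mathcal{A}\mid |Z|=k)\le\nu(\mathcal{A}\mid |Z|=k+1)$$ for every $k\ge 1$ and every increasing $\mathcal{A}\subseteq 2^{[m]}$, where the inequality is required only when both conditioning events $\{|Z|=k\}$ and $\{|Z|=k+1\}$ have positive probability. *)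

theory Defs
  imports "HOL-Probability.Probability"
begin

definition increasing_family :: "nat \<Rightarrow> nat set set \<Rightarrow> bool" where
  "increasing_family m \<A> \<longleftrightarrow>
     \<A> \<subseteq> Pow {1..m} \<and> (\<forall>S T. S \<in> \<A> \<longrightarrow> S \<subseteq> T \<longrightarrow> T \<subseteq> {1..m} \<longrightarrow> T \<in> \<A>)"

definition NMP :: "nat \<Rightarrow> nat set measure \<Rightarrow> bool" where
  "NMP m \<nu> \<longleftrightarrow>
     prob_space \<nu> \<and> sets \<nu> = Pow (Pow {1..m}) \<and>
     (\<forall>k\<ge>1. \<forall>\<A>. increasing_family m \<A> \<longrightarrow>
        \<P>(Z in \<nu>. card Z = k) > 0 \<longrightarrow> \<P>(Z in \<nu>. card Z = k + 1) > 0 \<longrightarrow>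
        \<P>(Z in \<nu>. Z \<in> \<A> \<bar> card Z = k) \<le> \<P>(Z in \<nu>. Z \<in> \<A> \<bar> card Z = k + 1))"

text \<open>The random function is given by its coordinates: \<open>\<sigma> i \<omega>\<close> is its value at \<open>i \<in> {1..m}\<close>
  for the outcome \<open>\<omega>\<close>, and \<open>fiber m \<sigma> j \<omega>\<close> is the random set of preimages of \<open>j\<close>.\<close>

definition fiber :: "nat \<Rightarrow> (nat \<Rightarrow> 'w \<Rightarrow> nat) \<Rightarrow> nat \<Rightarrow> 'w \<Rightarrow> nat set" where
  "fiber m \<sigma> j \<omega> = {i \<in> {1..m}. \<sigma> i \<omega> = j}"

text \<open>The vector \<open>a\<close> has length \<open>d\<close>; only the values \<open>a 1, \<dots>, a d\<close> are used.\<close>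

definition Q_event ::
  "'w measure \<Rightarrow> nat \<Rightarrow> (nat \<Rightarrow> 'w \<Rightarrow> nat) \<Rightarrow> nat \<Rightarrow> (nat \<Rightarrow> nat) \<Rightarrow> 'w set" where
  "Q_event M m \<sigma> d a = {\<omega> \<in> space M. \<forall>j\<in>{1..d}. card (fiber m \<sigma> j \<omega>) = a j}"

text \<open>\<open>uniform_measure M Q\<close> is \<open>M\<close> conditioned on the event \<open>Q\<close>.\<close>

definition cond_fiber_law ::
  "'w measure \<Rightarrow> nat \<Rightarrow> nat \<Rightarrow> (nat \<Rightarrow> 'w \<Rightarrow> nat) \<Rightarrow> nat \<Rightarrow> (nat \<Rightarrow> nat) \<Rightarrow> nat set measure" where
  "cond_fiber_law M m n \<sigma> d a =
     distr (uniform_measure M (Q_event M m \<sigma> d a)) (count_space (Pow {1..m})) (fiber m \<sigma> n)"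

end

theory Submission
  imports Defs
begin

text \<open>
  Give each function \<open>f : [m] \<rightarrow> [n]\<close> its probability \<open>W f\<close>. Clearing denominators, the theorem
  says that the sum of \<open>W f * W h * (g (h\<inverse> n) - g (f\<inverse> n))\<close> is nonnegative, where \<open>g\<close> is the
  indicator of the increasing family and \<open>f\<close>, \<open>h\<close> run over the functions with the prescribed loads
  in bins \<open>1, \<dots>, d\<close> that put \<open>k\<close>, respectively \<open>k + 1\<close>, balls into bin \<open>n\<close>.

  Superpose \<open>f\<close> and \<open>h\<close>: every ball \<open>i\<close> becomes an edge from the bin \<open>f i\<close> to the bin \<open>h i\<close>, so the
  pair is an oriented multigraph on the bins. Exchanging \<open>f i\<close> and \<open>h i\<close> for the balls in a set
  \<open>X\<close> reorients edges and leaves the weight \<open>W f * W h\<close> unchanged, so it suffices to fix the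
  multigraph and to sum over its orientations (\<open>sum_pairs_nonneg_by_flipping\<close>).
  For a multigraph of the right degrees, an orientation comes from a pair with the required loads
  exactly when it is admissible: out-degree equals in-degree in every bin \<open>1, \<dots>, d\<close>, and the out-degree
  exceeds the in-degree by one at the vertex \<open>w\<close> into which all the bins strictly between \<open>d\<close> and
  \<open>n\<close> are merged. The ends of edges at bin \<open>n\<close> carry their ball as a label, and what is compared
  is \<open>g\<close> of the labels at heads and at tails.

  That the sum over orientations is nonnegative for every multigraph and every monotone \<open>g\<close>
  (\<open>orientation_sum_nonneg\<close>) goes by induction on the number of edges. The idea is to let edges that
  meet at an unlabelled vertex \<open>v\<close> join up to longer trails. In an admissible orientation the number
  of pairs consisting of an edge into \<open>v\<close> and an edge out of \<open>v\<close> depends only on the degree of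
  \<open>v\<close> and on whether \<open>v = w\<close>, and it is positive if the degree is at least two
  (loops apart). Hence a positive multiple of the sum for the multigraph is the sum, over all pairs of edges at \<open>v\<close>, of the sums for the multigraphs in which the
  pair is replaced by a single edge (\<open>orientation_sum_nonneg_step\<close>). When no contraction is possible,
  admissibility forces a single edge at \<open>w\<close>, leading to a labelled end, while all other
  edges that are not loops join labelled ends. Pair each admissible orientation with the one
  obtained by reversing all these other edges: the head labels of the first are the tail labels of
  the second together with the label opposite to \<open>w\<close>, so monotonicity of \<open>g\<close> concludes
  (\<open>orientation_sum_nonneg_base\<close>).
\<close>

section \<open>Reorienting edges\<close>

text \<open>A family of edges is given by two functions \<open>s\<close> and \<open>t\<close> on an index set. The edge \<open>j\<close> has the
  ends \<open>s j\<close> and \<open>t j\<close>, and after reversal of the edges in \<open>X\<close> its tail is \<open>flip X s t j\<close> and its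
  head is \<open>flip X t s j\<close>.\<close>
definition flip :: "'j set \<Rightarrow> ('j \<Rightarrow> 'b) \<Rightarrow> ('j \<Rightarrow> 'b) \<Rightarrow> 'j \<Rightarrow> 'b" where
  "flip X s t = (\<lambda>j. if j \<in> X then t j else s j)"

lemma flip_flip: "flip X (flip Y s t) (flip Y t s) = flip (sym_diff X Y) s t"
  by (auto simp: flip_def fun_eq_iff)

lemma sum_Pow_sym_diff:
  fixes F :: "'j set \<Rightarrow> real"
  assumes "Y \<subseteq> J"
  shows "(\<Sum>X\<in>Pow J. F (sym_diff X Y)) = (\<Sum>X\<in>Pow J. F X)"
  by (rule sum.reindex_bij_witness[where i = "\<lambda>X. sym_diff X Y" and j = "\<lambda>X. sym_diff X Y"])
     (use assms in \<open>auto intro!: arg_cong[of _ _ F]\<close>)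

lemma sum_Pow_insert:
  fixes F :: "'j set \<Rightarrow> real"
  assumes "finite K" "e \<notin> K"
  shows "(\<Sum>X\<in>Pow (insert e K). F X) = (\<Sum>X\<in>Pow K. F X + F (insert e X))"
proof -
  have "inj_on (insert e) (Pow K)"
    using assms by (auto simp: inj_on_def)
  moreover have "Pow K \<inter> insert e ` Pow K = {}"
    using assms by auto
  ultimately show ?thesis
    using assms by (simp add: Pow_insert sum.union_disjoint sum.reindex sum.distrib)
qed

section \<open>Sums over the orientations of a multigraph\<close>

text \<open>An end of an edge is either \<open>Inl l\<close>, an end at the labelled vertex carrying the label \<open>l\<close>, or
  \<open>Inr v\<close>, an end at the unlabelled vertex \<open>v\<close>. Below, \<open>p\<close> gives the tails and \<open>q\<close> the heads of an
  orientation. A loop contributes nothing to the excess of its vertex.\<close>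
definition excess :: "'j set \<Rightarrow> ('j \<Rightarrow> 'l + 'v) \<Rightarrow> ('j \<Rightarrow> 'l + 'v) \<Rightarrow> 'v \<Rightarrow> int" where
  "excess J p q u = (\<Sum>j\<in>J. of_bool (p j = Inr u) - of_bool (q j = Inr u))"

definition labels :: "'j set \<Rightarrow> ('j \<Rightarrow> 'l + 'v) \<Rightarrow> 'l set" where
  "labels J p = {l. \<exists>j\<in>J. p j = Inl l}"

text \<open>The contribution of one orientation. The orientation is called admissible if it is balanced at
  every unlabelled vertex except for one surplus outgoing edge at \<open>w\<close>.\<close>
definition gain ::
  "('l set \<Rightarrow> real) \<Rightarrow> 'v \<Rightarrow> 'j set \<Rightarrow> ('j \<Rightarrow> 'l + 'v) \<Rightarrow> ('j \<Rightarrow> 'l + 'v) \<Rightarrow> real" where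
  "gain g w J p q =
     (if \<forall>u. excess J p q u = of_bool (u = w) then g (labels J q) - g (labels J p) else 0)"

lemma gain_cong:
  assumes "\<And>j. j \<in> J \<Longrightarrow> p j = p' j" "\<And>j. j \<in> J \<Longrightarrow> q j = q' j"
  shows "gain g w J p q = gain g w J p' q'"
proof -
  have "excess J p q = excess J p' q'" "labels J p = labels J p'" "labels J q = labels J q'"
    using assms by (auto simp: excess_def labels_def fun_eq_iff intro!: sum.cong)
  then show ?thesis by (simp add: gain_def)
qed

text \<open>An edge \<open>e\<close> into \<open>v\<close> followed by an edge \<open>f\<close> out of \<open>v\<close> may be replaced by one edge from the tail of
  \<open>e\<close> to the head of \<open>f\<close>: the contributions at \<open>v\<close> cancel, and no label is lost because \<open>v\<close> is
  unlabelled. The two versions keep the index \<open>e\<close>, respectively \<open>f\<close>, for the new edge.\<close>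
lemma gain_contract:
  assumes "finite K" "e \<notin> K" "f \<notin> K" "e \<noteq> f" "q e = Inr v" "p f = Inr v"
  shows "gain g w (insert e (insert f K)) p q = gain g w (insert e K) p (q(e := q f))"
    and "gain g w (insert e (insert f K)) p q = gain g w (insert f K) (p(f := p e)) q"
proof -
  have "(\<Sum>j\<in>K. of_bool (p j = Inr u) - of_bool ((q(e := q f)) j = Inr u)) =
      (\<Sum>j\<in>K. of_bool (p j = Inr u) - (of_bool (q j = Inr u) :: int))" for u
    by (rule sum.cong) (use assms in auto)
  then have "excess (insert e (insert f K)) p q u = excess (insert e K) p (q(e := q f)) u" for u
    using assms by (simp add: excess_def)
  moreover have "labels (insert e (insert f K)) p = labels (insert e K) p"
    using assms by (auto simp: labels_def)
  moreover have "labels (insert e (insert f K)) q = labels (insert e K) (q(e := q f))"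
    using assms by (auto simp: labels_def)
  ultimately show "gain g w (insert e (insert f K)) p q = gain g w (insert e K) p (q(e := q f))"
    by (simp add: gain_def)
  have "(\<Sum>j\<in>K. of_bool ((p(f := p e)) j = Inr u) - of_bool (q j = Inr u)) =
      (\<Sum>j\<in>K. of_bool (p j = Inr u) - (of_bool (q j = Inr u) :: int))" for u
    by (rule sum.cong) (use assms in auto)
  then have "excess (insert e (insert f K)) p q u = excess (insert f K) (p(f := p e)) q u" for u
    using assms by (simp add: excess_def)
  moreover have "labels (insert e (insert f K)) p = labels (insert f K) (p(f := p e))"
    using assms by (auto simp: labels_def)
  moreover have "labels (insert e (insert f K)) q = labels (insert f K) q"
    using assms by (auto simp: labels_def)
  ultimately show "gain g w (insert e (insert f K)) p q = gain g w (insert f K) (p(f := p e)) q"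
    by (simp add: gain_def)
qed

text \<open>The orientations in which one of \<open>e\<close>, \<open>f\<close> enters \<open>v\<close> and the other one leaves it are those that
  traverse the path \<open>e\<close>, \<open>f\<close> in one of its two directions, so they correspond to the orientations of
  the multigraph in which the path is a single edge.\<close>
lemma sum_opposite_pair_eq_contract:
  fixes g :: "'l set \<Rightarrow> real"
  assumes fin: "finite K" and K: "e \<notin> K" "f \<notin> K" "e \<noteq> f"
    and v: "t e = Inr v" "s f = Inr v" "s e \<noteq> Inr v" "t f \<noteq> Inr v"
  defines "J \<equiv> insert e (insert f K)"
  shows "(\<Sum>X\<in>Pow J. gain g w J (flip X s t) (flip X t s) *
            (of_bool (flip X t s e = Inr v \<and> flip X s t f = Inr v) +
             of_bool (flip X t s f = Inr v \<and> flip X s t e = Inr v))) =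
         (\<Sum>X\<in>Pow (insert e K). gain g w (insert e K) (flip X s (t(e := t f))) (flip X (t(e := t f)) s))"
    (is "(\<Sum>X\<in>Pow J. ?F X) = _")
proof -
  have "(\<Sum>X\<in>Pow J. ?F X) =
      (\<Sum>X\<in>Pow K. ?F X + ?F (insert f X) + (?F (insert e X) + ?F (insert f (insert e X))))"
    unfolding J_def using fin K by (simp add: sum_Pow_insert insert_commute sum.distrib)
  also have "\<dots> = (\<Sum>X\<in>Pow K. gain g w (insert e K) (flip X s (t(e := t f))) (flip X (t(e := t f)) s)
      + gain g w (insert e K) (flip (insert e X) s (t(e := t f))) (flip (insert e X) (t(e := t f)) s))"
  proof (rule sum.cong[OF refl])
    fix X assume "X \<in> Pow K"
    then have X: "e \<notin> X" "f \<notin> X" "X \<subseteq> K" using K by auto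
    have "gain g w J (flip X s t) (flip X t s) =
        gain g w (insert e K) (flip X s t) ((flip X t s)(e := flip X t s f))"
      unfolding J_def by (rule gain_contract) (use fin K X v in \<open>auto simp: flip_def\<close>)
    also have "\<dots> = gain g w (insert e K) (flip X s (t(e := t f))) (flip X (t(e := t f)) s)"
      by (rule gain_cong) (use X K in \<open>auto simp: flip_def\<close>)
    finally have 1: "gain g w J (flip X s t) (flip X t s) = \<dots>" .
    (* In the opposite direction the path enters through \<open>f\<close>; the index \<open>e\<close> is kept again. *)
    let ?Y = "insert f (insert e X)"
    have "gain g w J (flip ?Y s t) (flip ?Y t s) =
        gain g w (insert e K) ((flip ?Y s t)(e := flip ?Y s t f)) (flip ?Y t s)"
      unfolding J_def insert_commute[of e f]
      by (rule gain_contract) (use fin K X v in \<open>auto simp: flip_def\<close>)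
    also have "\<dots> = gain g w (insert e K) (flip (insert e X) s (t(e := t f)))
        (flip (insert e X) (t(e := t f)) s)"
      by (rule gain_cong) (use X K in \<open>auto simp: flip_def\<close>)
    finally have 2: "gain g w J (flip ?Y s t) (flip ?Y t s) = \<dots>" .
    have eqs: "?F X = gain g w J (flip X s t) (flip X t s)"
      "?F ?Y = gain g w J (flip ?Y s t) (flip ?Y t s)"
      "?F (insert f X) = 0" "?F (insert e X) = 0"
      using X K v by (auto simp: flip_def)
    show "?F X + ?F (insert f X) + (?F (insert e X) + ?F ?Y) =
      gain g w (insert e K) (flip X s (t(e := t f))) (flip X (t(e := t f)) s)
      + gain g w (insert e K) (flip (insert e X) s (t(e := t f))) (flip (insert e X) (t(e := t f)) s)"
      unfolding eqs by (simp only: 1 2 add_0_left add_0_right)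
  qed
  also have "\<dots> = (\<Sum>X\<in>Pow (insert e K). gain g w (insert e K) (flip X s (t(e := t f))) (flip X (t(e := t f)) s))"
    using fin K by (simp add: sum_Pow_insert)
  finally show ?thesis .
qed

text \<open>Loops are left out because both of their orientations enter and leave \<open>v\<close>: they would spoil the
  correspondence between orientations of a path and of its contraction.\<close>
definition touching :: "'j set \<Rightarrow> ('j \<Rightarrow> 'l + 'v) \<Rightarrow> ('j \<Rightarrow> 'l + 'v) \<Rightarrow> 'v \<Rightarrow> 'j set" where
  "touching J s t v = {j \<in> J. s j \<noteq> t j \<and> (s j = Inr v \<or> t j = Inr v)}"

definition orientation_sum ::
  "('l set \<Rightarrow> real) \<Rightarrow> 'v \<Rightarrow> 'j set \<Rightarrow> ('j \<Rightarrow> 'l + 'v) \<Rightarrow> ('j \<Rightarrow> 'l + 'v) \<Rightarrow> real" where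
  "orientation_sum g w J s t = (\<Sum>X\<in>Pow J. gain g w J (flip X s t) (flip X t s))"

text \<open>Reversing \<open>e\<close> and \<open>f\<close> in the reference orientation, if necessary, arranges that the reference
  orientation traverses the path from \<open>e\<close> to \<open>f\<close>. A sum over all orientations does not notice the
  change of reference.\<close>
lemma sum_opposite_pair_nonneg:
  fixes g :: "'l set \<Rightarrow> real"
  assumes fin: "finite J" and ef: "e \<in> touching J s t v" "f \<in> touching J s t v" "e \<noteq> f"
    and contracted: "\<And>s t. 0 \<le> orientation_sum g w (J - {f}) s t"
  shows "0 \<le> (\<Sum>X\<in>Pow J. gain g w J (flip X s t) (flip X t s) *
            (of_bool (flip X t s e = Inr v \<and> flip X s t f = Inr v) +
             of_bool (flip X t s f = Inr v \<and> flip X s t e = Inr v)))"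
    (is "0 \<le> (\<Sum>X\<in>Pow J. ?F (flip X s t) (flip X t s))")
proof -
  define Y where "Y = {j. j = e \<and> t e \<noteq> Inr v \<or> j = f \<and> s f \<noteq> Inr v}"
  define s' where "s' = flip Y s t"
  define t' where "t' = flip Y t s"
  define K where "K = J - {e, f}"
  have J: "J = insert e (insert f K)" and Jf: "J - {f} = insert e K"
    using ef by (auto simp: K_def touching_def)
  have "Y \<subseteq> J" using ef by (auto simp: Y_def touching_def)
  have "(\<Sum>X\<in>Pow J. ?F (flip X s' t') (flip X t' s')) = (\<Sum>X\<in>Pow J. ?F (flip X s t) (flip X t s))"
    unfolding s'_def t'_def flip_flip
    by (rule sum_Pow_sym_diff[OF \<open>Y \<subseteq> J\<close>, where F = "\<lambda>X. ?F (flip X s t) (flip X t s)"])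
  moreover have "(\<Sum>X\<in>Pow J. ?F (flip X s' t') (flip X t' s')) =
      orientation_sum g w (insert e K) s' (t'(e := t' f))"
    unfolding J orientation_sum_def
    by (rule sum_opposite_pair_eq_contract)
       (use fin ef in \<open>auto simp: K_def s'_def t'_def Y_def flip_def touching_def\<close>)
  ultimately show ?thesis
    using contracted[of s' "t'(e := t' f)"] by (simp add: Jf)
qed

text \<open>If \<open>a\<close> edges enter \<open>v\<close> and \<open>b\<close> edges leave it, there are \<open>a * b\<close> such pairs, and
  \<open>4 * a * b = (a + b)\<^sup>2 - (b - a)\<^sup>2\<close>. So the number of pairs is the same for all orientations with a
  given excess at \<open>v\<close>.\<close>
lemma opposite_pairs_count:
  fixes p q :: "'j \<Rightarrow> 'l + 'v" and v :: 'v
  assumes fin: "finite J"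
  defines "N \<equiv> touching J p q v"
  shows "4 * (\<Sum>e\<in>N. \<Sum>f\<in>N. of_bool (q e = Inr v \<and> p f = Inr v)) =
    (int (card N))\<^sup>2 - (excess J p q v)\<^sup>2"
proof -
  define a where "a = (\<Sum>e\<in>N. of_bool (q e = Inr v) :: int)"
  define b where "b = (\<Sum>e\<in>N. of_bool (p e = Inr v) :: int)"
  have finN: "finite N" using fin by (simp add: N_def touching_def)
  have "(\<Sum>e\<in>N. \<Sum>f\<in>N. of_bool (q e = Inr v \<and> p f = Inr v)) = a * b"
    unfolding a_def b_def sum_product by (simp only: of_bool_conj)
  moreover have "a + b = (\<Sum>e\<in>N. 1)"
    unfolding a_def b_def sum.distrib[symmetric]
    by (rule sum.cong) (auto simp: N_def touching_def)
  moreover have "b - a = excess J p q v"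
    unfolding a_def b_def sum_subtractf[symmetric] excess_def
    by (rule sum.mono_neutral_left) (use fin in \<open>auto simp: N_def touching_def\<close>)
  moreover have "4 * (a * b) = (a + b)\<^sup>2 - (b - a)\<^sup>2"
    by (simp add: power2_eq_square algebra_simps)
  ultimately show ?thesis by simp
qed

text \<open>Double counting of the triples of an admissible orientation, an edge into \<open>v\<close> and an edge out of
  \<open>v\<close>. By \<open>opposite_pairs_count\<close> every admissible orientation is counted equally often, and grouping by
  the two edges gives orientation sums with one edge less. At least two edges are needed at \<open>v\<close>: the
  excess is at most one, so that only then the multiplicity is positive.\<close>
lemma orientation_sum_nonneg_step:
  fixes g :: "'l set \<Rightarrow> real"
  assumes fin: "finite J" and two: "2 \<le> card (touching J s t v)"
    and contracted: "\<And>f s t. f \<in> J \<Longrightarrow> 0 \<le> orientation_sum g w (J - {f}) s t"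
  shows "0 \<le> orientation_sum g w J s t"
proof -
  define N where "N = touching J s t v"
  define G where "G X = gain g w J (flip X s t) (flip X t s)" for X
  define pass where "pass X e f = (of_bool (flip X t s e = Inr v \<and> flip X s t f = Inr v) :: real)"
    for X e f
  define c where "c = ((real (card N))\<^sup>2 - of_bool (v = w)) / 4"
  have N: "touching J (flip X s t) (flip X t s) v = N" for X
    by (auto simp: N_def touching_def flip_def)
  (* The excess of \<open>v\<close> is \<open>of_bool (v = w)\<close>, which is its own square. *)
  have "2\<^sup>2 \<le> (real (card N))\<^sup>2"
    using two unfolding N_def by (intro power_mono) auto
  then have "of_bool (v = w) < (real (card N))\<^sup>2"
    by (rule less_le_trans[rotated]) simp
  then have "0 < c"
    unfolding c_def by (intro divide_pos_pos) (simp_all only: diff_gt_0_iff_gt zero_less_numeral)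
  have count: "G X * (\<Sum>e\<in>N. \<Sum>f\<in>N. pass X e f) = c * G X" for X
  proof (cases "\<forall>u. excess J (flip X s t) (flip X t s) u = of_bool (u = w)")
    case True
    have "4 * (\<Sum>e\<in>N. \<Sum>f\<in>N. pass X e f) =
        real_of_int (4 * (\<Sum>e\<in>N. \<Sum>f\<in>N. of_bool (flip X t s e = Inr v \<and> flip X s t f = Inr v)))"
      by (simp add: pass_def)
    also have "\<dots> = real_of_int ((int (card N))\<^sup>2 - (of_bool (v = w))\<^sup>2)"
      using opposite_pairs_count[OF fin, where p = "flip X s t" and q = "flip X t s" and v = v] True by (simp add: N)
    also have "\<dots> = 4 * c" by (simp add: c_def)
    finally show ?thesis by simp
  next
    case False
    then show ?thesis unfolding G_def gain_def by (simp only: if_False mult_zero_left mult_zero_right)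
  qed
  have pair: "0 \<le> (\<Sum>X\<in>Pow J. G X * (pass X e f + pass X f e))" if "e \<in> N" "f \<in> N" for e f
  proof (cases "e = f")
    case True
    have "pass X f f = 0" for X
      using that by (auto simp: pass_def N_def touching_def flip_def)
    then show ?thesis using True by simp
  next
    case False
    then show ?thesis
      unfolding G_def pass_def using that fin contracted
      by (intro sum_opposite_pair_nonneg) (auto simp: N_def touching_def)
  qed
  have "0 \<le> (\<Sum>e\<in>N. \<Sum>f\<in>N. \<Sum>X\<in>Pow J. G X * (pass X e f + pass X f e))"
    by (intro sum_nonneg pair)
  also have "\<dots> = (\<Sum>X\<in>Pow J. \<Sum>e\<in>N. \<Sum>f\<in>N. G X * (pass X e f + pass X f e))"
    by (simp only: sum.swap[of _ "Pow J"])
  also have "\<dots> = (\<Sum>X\<in>Pow J. G X * ((\<Sum>e\<in>N. \<Sum>f\<in>N. pass X e f) + (\<Sum>e\<in>N. \<Sum>f\<in>N. pass X f e)))"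
    by (simp add: sum.distrib sum_distrib_left ring_distribs)
  also have "\<dots> = (\<Sum>X\<in>Pow J. 2 * c * G X)"
  proof (rule sum.cong[OF refl])
    fix X
    have "(\<Sum>e\<in>N. \<Sum>f\<in>N. pass X f e) = (\<Sum>e\<in>N. \<Sum>f\<in>N. pass X e f)"
      by (rule sum.swap)
    then show "G X * ((\<Sum>e\<in>N. \<Sum>f\<in>N. pass X e f) + (\<Sum>e\<in>N. \<Sum>f\<in>N. pass X f e)) = 2 * c * G X"
      using count[of X] by (simp add: ring_distribs)
  qed
  also have "\<dots> = 2 * c * orientation_sum g w J s t"
    by (simp add: orientation_sum_def G_def sum_distrib_left)
  finally show ?thesis
    using \<open>0 < c\<close> by (simp add: zero_le_mult_iff)
qed

text \<open>A vertex with a single edge (loops apart) has excess \<open>1\<close> or \<open>-1\<close>. So if some orientation is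
  admissible, only \<open>w\<close> has an edge other than loops, this edge \<open>e\<close> ends at a label, and
  an orientation is admissible iff \<open>e\<close> leaves \<open>w\<close>. Reversing all edges but \<open>e\<close> permutes the admissible orientations and
  turns the tail labels of the new orientation into head labels of the old one, because \<open>e\<close> has no
  label at its tail.\<close>
lemma orientation_sum_nonneg_base:
  fixes g :: "'l set \<Rightarrow> real"
  assumes fin: "finite J" and one: "\<And>v. card (touching J s t v) \<le> 1" and "mono g"
  shows "0 \<le> orientation_sum g w J s t"
proof -
  define good where
    "good X \<longleftrightarrow> (\<forall>u. excess J (flip X s t) (flip X t s) u = of_bool (u = w))" for X
  have gain: "gain g w J (flip X s t) (flip X t s) =
      of_bool (good X) * (g (labels J (flip X t s)) - g (labels J (flip X s t)))" for X
    unfolding gain_def good_def by simp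
  show ?thesis
  proof (cases "\<exists>X\<in>Pow J. good X")
    case False
    then show ?thesis
      unfolding orientation_sum_def by (intro sum_nonneg) (simp add: gain)
  next
    case True
    then obtain X0 where X0: "X0 \<subseteq> J" "good X0" by auto
    have finT: "finite (touching J s t v)" for v using fin by (simp add: touching_def)
    have uniq: "i = j" if "i \<in> touching J s t v" "j \<in> touching J s t v" for i j v
      using that one[of v] finT[of v] by (auto simp: card_le_Suc0_iff_eq)
    have excess_touching: "excess J (flip X s t) (flip X t s) u =
        (\<Sum>j\<in>touching J s t u. of_bool (flip X s t j = Inr u) - of_bool (flip X t s j = Inr u))" for X u
      unfolding excess_def
      by (rule sum.mono_neutral_right) (use fin in \<open>auto simp: touching_def flip_def\<close>)
    have "touching J s t w \<noteq> {}"
      using X0(2) excess_touching[of X0 w] by (auto simp: good_def)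
    then obtain e where e: "e \<in> touching J s t w" by auto
    then have Tw: "touching J s t w = {e}" using uniq by auto
    have T0: "touching J s t u = {}" if "u \<noteq> w" for u
    proof (rule ccontr)
      assume "touching J s t u \<noteq> {}"
      then obtain j where "j \<in> touching J s t u" by auto
      moreover from this have "touching J s t u = {j}" using uniq by auto
      ultimately show False
        using X0(2) that excess_touching[of X0 u]
        by (auto simp: good_def touching_def flip_def split: if_splits)
    qed
    have good_iff: "good X \<longleftrightarrow> flip X s t e = Inr w" for X
    proof -
      have "excess J (flip X s t) (flip X t s) u = 0" if "u \<noteq> w" for u
        using that by (simp add: excess_touching T0)
      moreover have "excess J (flip X s t) (flip X t s) w = 1 \<longleftrightarrow> flip X s t e = Inr w"
        unfolding excess_touching Tw using e by (auto simp: flip_def touching_def)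
      ultimately show ?thesis by (auto simp: good_def)
    qed
    let ?rev = "\<lambda>X. sym_diff X (J - {e})"
    have good_rev: "good (?rev X) \<longleftrightarrow> good X" for X
      by (simp add: good_iff flip_def)
    have sub: "labels J (flip (?rev X) s t) \<subseteq> labels J (flip X t s)" if "good X" for X
    proof
      fix l assume "l \<in> labels J (flip (?rev X) s t)"
      then obtain j where j: "j \<in> J" "flip (?rev X) s t j = Inl l" by (auto simp: labels_def)
      moreover have "j \<noteq> e"
        using j that by (auto simp: good_iff flip_def split: if_splits)
      ultimately show "l \<in> labels J (flip X t s)"
        by (auto simp: labels_def flip_def split: if_splits)
    qed
    have "(\<Sum>X\<in>Pow J. of_bool (good X) * g (labels J (flip X s t))) =
        (\<Sum>X\<in>Pow J. of_bool (good (?rev X)) * g (labels J (flip (?rev X) s t)))"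
      by (rule sum_Pow_sym_diff[symmetric]) auto
    also have "\<dots> \<le> (\<Sum>X\<in>Pow J. of_bool (good X) * g (labels J (flip X t s)))"
      unfolding good_rev using sub by (intro sum_mono) (auto intro: monoD[OF \<open>mono g\<close>])
    finally have "0 \<le> (\<Sum>X\<in>Pow J. of_bool (good X) * g (labels J (flip X t s))
        - of_bool (good X) * g (labels J (flip X s t)))"
      by (simp add: sum_subtractf)
    also have "\<dots> = orientation_sum g w J s t"
      unfolding orientation_sum_def by (simp add: gain ring_distribs)
    finally show ?thesis .
  qed
qed

lemma orientation_sum_nonneg:
  fixes g :: "'l set \<Rightarrow> real"
  assumes "finite J" "mono g"
  shows "0 \<le> orientation_sum g w J s t"
  using assms(1)
proof (induction "card J" arbitrary: J s t rule: less_induct)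
  case less
  show ?case
  proof (cases "\<exists>v. 2 \<le> card (touching J s t v)")
    case True
    then obtain v where "2 \<le> card (touching J s t v)" by auto
    then show ?thesis
    proof (rule orientation_sum_nonneg_step[OF less.prems])
      fix f s' t' assume "f \<in> J"
      then show "0 \<le> orientation_sum g w (J - {f}) s' t'"
        using less.prems by (intro less.hyps card_Diff1_less) auto
    qed
  next
    case False
    then have "card (touching J s t v) \<le> 1" for v
      by (metis not_less_eq_eq numeral_2_eq_2 One_nat_def)
    then show ?thesis
      by (rule orientation_sum_nonneg_base[OF less.prems _ \<open>mono g\<close>])
  qed
qed

section \<open>Balls in urns\<close>

lemma sum_PiE_flip:
  fixes D :: "('i \<Rightarrow> 'b) \<Rightarrow> ('i \<Rightarrow> 'b) \<Rightarrow> real"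
  shows "(\<Sum>f\<in>PiE I B. \<Sum>h\<in>PiE I B. D (flip X f h) (flip X h f)) =
    (\<Sum>f\<in>PiE I B. \<Sum>h\<in>PiE I B. D f h)"
  unfolding sum.cartesian_product
  by (rule sum.reindex_bij_witness[where i = "\<lambda>(f, h). (flip X f h, flip X h f)"
        and j = "\<lambda>(f, h). (flip X f h, flip X h f)"])
     (auto simp: flip_def PiE_iff extensional_def split: if_splits)

text \<open>Exchanging values of \<open>f\<close> and \<open>h\<close> permutes the pairs and preserves their weight, so \<open>D\<close> may be
  averaged over all exchanges.\<close>
lemma sum_pairs_nonneg_by_flipping:
  fixes p :: "'i \<Rightarrow> 'b \<Rightarrow> real"
  assumes "finite I" and p: "\<And>i b. 0 \<le> p i b"
    and D: "\<And>f h. f \<in> PiE I B \<Longrightarrow> h \<in> PiE I B \<Longrightarrow>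
      0 \<le> (\<Sum>X\<in>Pow I. D (flip X f h) (flip X h f))"
  shows "0 \<le> (\<Sum>f\<in>PiE I B. \<Sum>h\<in>PiE I B. (\<Prod>i\<in>I. p i (f i)) * (\<Prod>i\<in>I. p i (h i)) * D f h)"
    (is "0 \<le> ?S")
proof -
  define W where "W f h = (\<Prod>i\<in>I. p i (f i)) * (\<Prod>i\<in>I. p i (h i))" for f h
  have W_flip: "W (flip X f h) (flip X h f) = W f h" for X f h
    unfolding W_def prod.distrib[symmetric] by (rule prod.cong) (auto simp: flip_def)
  have "(\<Sum>X\<in>Pow I. ?S) = (\<Sum>X\<in>Pow I. \<Sum>f\<in>PiE I B. \<Sum>h\<in>PiE I B.
      W (flip X f h) (flip X h f) * D (flip X f h) (flip X h f))"
    using sum_PiE_flip[where D = "\<lambda>f h. W f h * D f h"] by (simp add: W_def)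
  also have "\<dots> = (\<Sum>f\<in>PiE I B. \<Sum>h\<in>PiE I B. W f h * (\<Sum>X\<in>Pow I. D (flip X f h) (flip X h f)))"
    unfolding W_flip by (simp only: sum.swap[of _ _ "Pow I"] sum_distrib_left)
  also have "\<dots> \<ge> 0"
    unfolding W_def by (intro sum_nonneg mult_nonneg_nonneg prod_nonneg D p)
  finally show ?thesis
    using \<open>finite I\<close> by (simp add: card_Pow zero_le_mult_iff power_le_zero_eq)
qed

definition load :: "'i set \<Rightarrow> ('i \<Rightarrow> nat) \<Rightarrow> nat \<Rightarrow> nat" where
  "load I f j = card {i \<in> I. f i = j}"

definition loaded :: "'i set \<Rightarrow> nat \<Rightarrow> (nat \<Rightarrow> nat) \<Rightarrow> nat \<Rightarrow> nat \<Rightarrow> ('i \<Rightarrow> nat) \<Rightarrow> bool" where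
  "loaded I d a n k f \<longleftrightarrow> (\<forall>j\<in>{1..d}. load I f j = a j) \<and> load I f n = k"

text \<open>The vertex at which ball \<open>i\<close> attaches. All the bins that are neither bin \<open>n\<close> nor have a prescribed
  load form the vertex \<open>0\<close>, which is free because bins are numbered from \<open>1\<close>.\<close>
definition urn_end :: "nat \<Rightarrow> nat \<Rightarrow> ('i \<Rightarrow> nat) \<Rightarrow> 'i \<Rightarrow> 'i + nat" where
  "urn_end d n f i = (if f i = n then Inl i else if f i \<le> d then Inr (f i) else Inr 0)"

lemma flip_urn_end: "flip X (urn_end d n f) (urn_end d n h) = urn_end d n (flip X f h)"
  by (auto simp: flip_def urn_end_def)

lemma labels_urn_end: "labels I (urn_end d n f) = {i \<in> I. f i = n}"
  by (auto simp: labels_def urn_end_def split: if_splits)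

lemma load_eq_sum: "finite I \<Longrightarrow> load I f j = (\<Sum>i\<in>I. of_bool (f i = j))"
  by (simp add: load_def Int_def)

lemma load_flip:
  assumes "finite I"
  shows "load I (flip X f h) j + load I (flip X h f) j = load I f j + load I h j"
  unfolding load_eq_sum[OF assms] sum.distrib[symmetric]
  by (rule sum.cong) (auto simp: flip_def)

lemma excess_urn_end:
  assumes "finite I" "d < n" and f: "f \<in> PiE I (\<lambda>_. {1..n})" and h: "h \<in> PiE I (\<lambda>_. {1..n})"
  shows "u \<in> {1..d} \<Longrightarrow> excess I (urn_end d n f) (urn_end d n h) u = int (load I f u) - int (load I h u)"
    and "d < u \<Longrightarrow> excess I (urn_end d n f) (urn_end d n h) u = 0"
    and "excess I (urn_end d n f) (urn_end d n h) 0 =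
      (\<Sum>j\<in>{1..d}. int (load I h j) - int (load I f j)) + (int (load I h n) - int (load I f n))"
proof -
  show "excess I (urn_end d n f) (urn_end d n h) u = int (load I f u) - int (load I h u)"
    if "u \<in> {1..d}"
    unfolding excess_def load_eq_sum[OF \<open>finite I\<close>] of_nat_sum sum_subtractf[symmetric]
    by (rule sum.cong) (use that \<open>d < n\<close> in \<open>auto simp: urn_end_def\<close>)
  show "excess I (urn_end d n f) (urn_end d n h) u = 0" if "d < u"
    unfolding excess_def by (rule sum.neutral) (use that in \<open>auto simp: urn_end_def\<close>)
  (* A ball sits at the vertex \<open>0\<close> iff it lies in neither bin \<open>n\<close> nor a bin with prescribed load. *)
  have rest: "of_bool (urn_end d n f i = Inr 0) =
      1 - (of_bool (f i = n) :: int) - (\<Sum>j\<in>{1..d}. of_bool (f i = j))"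
    if "i \<in> I" "f \<in> PiE I (\<lambda>_. {1..n})" for i f
  proof -
    have fi: "1 \<le> f i" using that by auto
    have "(\<Sum>j\<in>{1..d}. of_bool (f i = j)) = (of_bool (f i \<in> {1..d}) :: int)"
      by (simp add: of_bool_def)
    then show ?thesis
      using fi \<open>d < n\<close> by (auto simp: urn_end_def)
  qed
  have swap: "(\<Sum>i\<in>I. \<Sum>j\<in>{1..d}. of_bool (f i = j)) =
      (\<Sum>j\<in>{1..d}. \<Sum>i\<in>I. of_bool (f i = j) :: int)" for f
    by (rule sum.swap)
  have "excess I (urn_end d n f) (urn_end d n h) 0 =
      (\<Sum>i\<in>I. (1 - of_bool (f i = n) - (\<Sum>j\<in>{1..d}. of_bool (f i = j))) -
        (1 - of_bool (h i = n) - (\<Sum>j\<in>{1..d}. of_bool (h i = j))))"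
    unfolding excess_def by (rule sum.cong) (use rest f h in auto)
  also have "\<dots> = (\<Sum>j\<in>{1..d}. \<Sum>i\<in>I. of_bool (h i = j)) - (\<Sum>j\<in>{1..d}. \<Sum>i\<in>I. of_bool (f i = j))
      + ((\<Sum>i\<in>I. of_bool (h i = n)) - (\<Sum>i\<in>I. of_bool (f i = n)))"
    unfolding sum_subtractf swap by linarith
  finally show "excess I (urn_end d n f) (urn_end d n h) 0 =
      (\<Sum>j\<in>{1..d}. int (load I h j) - int (load I f j)) + (int (load I h n) - int (load I f n))"
    unfolding load_eq_sum[OF \<open>finite I\<close>] of_nat_sum sum_subtractf by simp
qed

text \<open>The conditions on the loads split into one on the sums of loads, which exchanges of values of
  \<open>f\<close> and \<open>h\<close> do not affect, and the admissibility of the orientation. There is no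
  condition at bin \<open>n\<close> in the latter: the excess there is determined by the others, since all
  balls together have as many heads as tails.\<close>
lemma loaded_pair_iff:
  assumes "finite I" "d < n" "f \<in> PiE I (\<lambda>_. {1..n})" "h \<in> PiE I (\<lambda>_. {1..n})"
  shows "loaded I d a n k f \<and> loaded I d a n (k + 1) h \<longleftrightarrow>
    ((\<forall>j\<in>{1..d}. load I f j + load I h j = 2 * a j) \<and> load I f n + load I h n = 2 * k + 1) \<and>
    (\<forall>u. excess I (urn_end d n f) (urn_end d n h) u = of_bool (u = 0))"
    (is "?L \<longleftrightarrow> ?T \<and> ?E")
proof
  note ex = excess_urn_end[OF assms]
  show "?T \<and> ?E" if ?L
  proof (intro conjI allI)
    fix u
    consider "u = 0" | "u \<in> {1..d}" | "d < u" by fastforce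
    then show "excess I (urn_end d n f) (urn_end d n h) u = of_bool (u = 0)"
      using that by cases (auto simp: ex loaded_def)
  qed (use that in \<open>auto simp: loaded_def\<close>)
  show ?L if TE: "?T \<and> ?E"
  proof -
    have eq: "load I f j = a j \<and> load I h j = a j" if j: "j \<in> {1..d}" for j
    proof -
      have "int (load I f j) - int (load I h j) = 0"
        using TE ex(1)[OF j] j by auto
      moreover have "load I f j + load I h j = 2 * a j" using TE j by blast
      ultimately show ?thesis by linarith
    qed
    have "int (load I h n) - int (load I f n) = 1"
      using TE ex(3) eq by auto
    moreover have "load I f n + load I h n = 2 * k + 1" using TE by blast
    ultimately have "load I f n = k \<and> load I h n = k + 1" by linarith
    then show ?thesis using eq by (auto simp: loaded_def)
  qed
qed

text \<open>Multiplying out the conditional probabilities leaves a sum over pairs \<open>f\<close>, \<open>h\<close> that is bilinear in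
  the product weight. Averaged over exchanges, it becomes an orientation sum for the multigraph
  of each pair.\<close>
lemma weighted_urn_NMP:
  fixes p :: "'i \<Rightarrow> nat \<Rightarrow> real" and g :: "'i set \<Rightarrow> real" and a :: "nat \<Rightarrow> nat"
  assumes fin: "finite I" and "d < n" and p: "\<And>i b. 0 \<le> p i b" and "mono g"
  defines "F \<equiv> PiE I (\<lambda>_. {1..n})"
  defines "mass k u \<equiv> (\<Sum>f\<in>F. (\<Prod>i\<in>I. p i (f i)) * (of_bool (loaded I d a n k f) * u {i \<in> I. f i = n}))"
  shows "mass k g * mass (k + 1) (\<lambda>_. 1) \<le> mass (k + 1) g * mass k (\<lambda>_. 1)"
proof -
  define D where "D f h = of_bool (loaded I d a n k f \<and> loaded I d a n (k + 1) h) *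
    (g {i \<in> I. h i = n} - g {i \<in> I. f i = n})" for f h
  have "0 \<le> (\<Sum>f\<in>F. \<Sum>h\<in>F. (\<Prod>i\<in>I. p i (f i)) * (\<Prod>i\<in>I. p i (h i)) * D f h)"
    unfolding F_def
  proof (rule sum_pairs_nonneg_by_flipping[OF fin p])
    fix f h :: "'i \<Rightarrow> nat"
    assume fh: "f \<in> PiE I (\<lambda>_. {1..n})" "h \<in> PiE I (\<lambda>_. {1..n})"
    define T where "T \<longleftrightarrow> (\<forall>j\<in>{1..d}. load I f j + load I h j = 2 * a j) \<and>
      load I f n + load I h n = 2 * k + 1"
    have "D (flip X f h) (flip X h f) = of_bool T *
      gain g 0 I (flip X (urn_end d n f) (urn_end d n h)) (flip X (urn_end d n h) (urn_end d n f))"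
      for X
    proof -
      have F: "flip X f h \<in> PiE I (\<lambda>_. {1..n})" "flip X h f \<in> PiE I (\<lambda>_. {1..n})"
        using fh by (auto simp: flip_def PiE_iff extensional_def)
      show ?thesis
        unfolding D_def loaded_pair_iff[OF fin \<open>d < n\<close> F] load_flip[OF fin] T_def[symmetric]
        by (simp add: gain_def flip_urn_end labels_urn_end)
    qed
    then have "(\<Sum>X\<in>Pow I. D (flip X f h) (flip X h f)) =
        of_bool T * orientation_sum g 0 I (urn_end d n f) (urn_end d n h)"
      by (simp add: orientation_sum_def sum_distrib_left)
    also have "\<dots> \<ge> 0"
      by (intro mult_nonneg_nonneg orientation_sum_nonneg fin \<open>mono g\<close>) simp
    finally show "0 \<le> (\<Sum>X\<in>Pow I. D (flip X f h) (flip X h f))" .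
  qed
  also have "\<dots> = mass k (\<lambda>_. 1) * mass (k + 1) g - mass k g * mass (k + 1) (\<lambda>_. 1)"
    unfolding mass_def sum_product sum_subtractf[symmetric]
    by (intro sum.cong refl) (simp add: D_def of_bool_conj algebra_simps)
  finally show ?thesis by (simp add: mult.commute)
qed

section \<open>From weights to probabilities\<close>

lemma (in prob_space) prob_indep_finite_range:
  fixes \<sigma> :: "'i \<Rightarrow> 'a \<Rightarrow> 'b"
  assumes "finite I" "I \<noteq> {}" "finite B" and indep: "indep_vars (\<lambda>_. count_space B) \<sigma> I"
  shows "prob {\<omega> \<in> space M. P (restrict (\<lambda>i. \<sigma> i \<omega>) I)} =
    (\<Sum>f\<in>PiE I (\<lambda>_. B). (\<Prod>i\<in>I. prob (\<sigma> i -` {f i} \<inter> space M)) * of_bool (P f))"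
    and "{\<omega> \<in> space M. P (restrict (\<lambda>i. \<sigma> i \<omega>) I)} \<in> events"
proof -
  define E where "E f = (\<Inter>i\<in>I. \<sigma> i -` {f i} \<inter> space M)" for f
  have rv: "random_variable (count_space B) (\<sigma> i)" if "i \<in> I" for i
    using indep that by (auto simp: indep_vars_def)
  have finF: "finite (PiE I (\<lambda>_. B))"
    using assms by (intro finite_PiE) auto
  have E_ev: "E f \<in> events" if "f \<in> PiE I (\<lambda>_. B)" for f
    unfolding E_def using that \<open>finite I\<close> \<open>I \<noteq> {}\<close>
    by (intro sets.finite_INT measurable_sets[OF rv]) auto
  have prob_E: "prob (E f) = (\<Prod>i\<in>I. prob (\<sigma> i -` {f i} \<inter> space M))" if "f \<in> PiE I (\<lambda>_. B)" for f
    unfolding E_def using that assms by (intro indep_varsD_finite[OF indep]) auto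
  have E_iff: "\<omega> \<in> E f \<longleftrightarrow> \<omega> \<in> space M \<and> restrict (\<lambda>i. \<sigma> i \<omega>) I = f"
    if "f \<in> PiE I (\<lambda>_. B)" for f \<omega>
    using that \<open>I \<noteq> {}\<close> by (auto simp: E_def PiE_iff extensional_def restrict_def fun_eq_iff)
  have "restrict (\<lambda>i. \<sigma> i \<omega>) I \<in> PiE I (\<lambda>_. B)" if "\<omega> \<in> space M" for \<omega>
    using measurable_space[OF rv that] by auto
  then have split: "{\<omega> \<in> space M. P (restrict (\<lambda>i. \<sigma> i \<omega>) I)} = (\<Union>f\<in>{f \<in> PiE I (\<lambda>_. B). P f}. E f)"
    using E_iff by auto
  show "{\<omega> \<in> space M. P (restrict (\<lambda>i. \<sigma> i \<omega>) I)} \<in> events"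
    unfolding split using finF E_ev by (intro sets.finite_UN) auto
  have "prob {\<omega> \<in> space M. P (restrict (\<lambda>i. \<sigma> i \<omega>) I)} = (\<Sum>f\<in>{f \<in> PiE I (\<lambda>_. B). P f}. prob (E f))"
    unfolding split using finF E_ev E_iff
    by (intro finite_measure_finite_Union) (auto simp: disjoint_family_on_def)
  also have "\<dots> = (\<Sum>f\<in>PiE I (\<lambda>_. B). (\<Prod>i\<in>I. prob (\<sigma> i -` {f i} \<inter> space M)) * of_bool (P f))"
    using finF prob_E by (intro sum.mono_neutral_cong_left) auto
  finally show "prob {\<omega> \<in> space M. P (restrict (\<lambda>i. \<sigma> i \<omega>) I)} = \<dots>" .
qed

theorem theorem1p5:
  fixes M :: "'w measure" and \<sigma> :: "nat \<Rightarrow> 'w \<Rightarrow> nat"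
    and m n d :: nat and a :: "nat \<Rightarrow> nat"
  assumes "prob_space M"
    and "m \<ge> 1" and "n \<ge> 1"
    and "prob_space.indep_vars M (\<lambda>_. count_space {1..n}) \<sigma> {1..m}"
    and "d \<le> n - 1"
    and "measure M (Q_event M m \<sigma> d a) > 0"
  shows "NMP m (cond_fiber_law M m n \<sigma> d a)"
proof -
  interpret prob_space M by fact
  define I where "I = {1..m}"
  define Q where "Q = Q_event M m \<sigma> d a"
  define U where "U = uniform_measure M Q"
  define \<nu> where "\<nu> = cond_fiber_law M m n \<sigma> d a"
  define p where "p i b = prob (\<sigma> i -` {b} \<inter> space M)" for i b
  define mass where "mass k u = (\<Sum>f\<in>PiE I (\<lambda>_. {1..n}).
    (\<Prod>i\<in>I. p i (f i)) * (of_bool (loaded I d a n k f) * u {i \<in> I. f i = n}))" for k u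
  have I: "finite I" "I \<noteq> {}" and "d < n"
    using assms by (auto simp: I_def)
  note law = prob_indep_finite_range[OF I finite_atLeastAtMost assms(4)[folded I_def]]
  have fiber: "fiber m \<sigma> j \<omega> = {i \<in> I. restrict (\<lambda>i. \<sigma> i \<omega>) I i = j}" for j \<omega>
    by (auto simp: fiber_def I_def)
  have fiber_meas: "fiber m \<sigma> n \<in> measurable M (count_space (Pow {1..m}))"
  proof (rule measurable_count_space_eq2[THEN iffD2])
    show "finite (Pow {1..m})" by simp
    have "fiber m \<sigma> n -` {S} \<inter> space M = {\<omega> \<in> space M. {i \<in> I. restrict (\<lambda>i. \<sigma> i \<omega>) I i = n} = S}" for S
      by (auto simp: fiber)
    then have "fiber m \<sigma> n -` {S} \<inter> space M \<in> events" for S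
      using law(2)[of "\<lambda>f. {i \<in> I. f i = n} = S"] by simp
    then show "fiber m \<sigma> n \<in> space M \<rightarrow> Pow {1..m} \<and>
        (\<forall>S\<in>Pow {1..m}. fiber m \<sigma> n -` {S} \<inter> space M \<in> events)"
      by (auto simp: fiber_def)
  qed
  have Q_eq: "Q = {\<omega> \<in> space M. \<forall>j\<in>{1..d}. load I (restrict (\<lambda>i. \<sigma> i \<omega>) I) j = a j}"
    by (simp add: Q_def Q_event_def fiber load_def)
  have Q_ev: "Q \<in> events"
    unfolding Q_eq by (rule law(2))
  have "0 < prob Q" using assms(6) by (simp add: Q_def)
  then have U_prob: "prob_space U"
    unfolding U_def by (intro prob_space_uniform_measure) (auto simp: emeasure_eq_measure)
  have fiber_U: "fiber m \<sigma> n \<in> measurable U (count_space (Pow {1..m}))"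
    using fiber_meas unfolding U_def by (subst measurable_cong_sets[OF sets_uniform_measure refl])
  have \<nu>: "\<nu> = distr U (count_space (Pow {1..m})) (fiber m \<sigma> n)"
    by (simp add: \<nu>_def cond_fiber_law_def U_def Q_def)
  have \<nu>_prob: "\<P>(Z in \<nu>. R Z \<and> card Z = k) = mass k (\<lambda>Z. of_bool (R Z)) / prob Q" for R k
  proof -
    have T: "fiber m \<sigma> n -` {Z \<in> Pow {1..m}. R Z \<and> card Z = k} \<inter> space M \<in> events"
      by (rule measurable_sets[OF fiber_meas]) auto
    have "\<P>(Z in \<nu>. R Z \<and> card Z = k) =
        measure U (fiber m \<sigma> n -` {Z \<in> Pow {1..m}. R Z \<and> card Z = k} \<inter> space U)"
      unfolding \<nu> by (subst measure_distr[OF fiber_U]) (auto simp: space_distr)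
    also have "\<dots> = prob (Q \<inter> (fiber m \<sigma> n -` {Z \<in> Pow {1..m}. R Z \<and> card Z = k} \<inter> space M)) / prob Q"
      unfolding U_def space_uniform_measure using \<open>0 < prob Q\<close>
      by (subst measure_uniform_measure[OF _ _ T]) (simp_all add: emeasure_eq_measure)
    also have "Q \<inter> (fiber m \<sigma> n -` {Z \<in> Pow {1..m}. R Z \<and> card Z = k} \<inter> space M) =
        {\<omega> \<in> space M. (\<lambda>f. loaded I d a n k f \<and> R {i \<in> I. f i = n}) (restrict (\<lambda>i. \<sigma> i \<omega>) I)}"
      by (auto simp: Q_eq fiber loaded_def load_def I_def)
    also have "prob \<dots> = mass k (\<lambda>Z. of_bool (R Z))"
      using law(1)[of "\<lambda>f. loaded I d a n k f \<and> R {i \<in> I. f i = n}"]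
      by (simp only: mass_def p_def of_bool_conj)
    finally show ?thesis .
  qed
  show ?thesis
    unfolding NMP_def \<nu>_def[symmetric]
  proof (intro conjI allI impI)
    show "prob_space \<nu>"
      unfolding \<nu> by (rule prob_space.prob_space_distr[OF U_prob fiber_U])
    show "sets \<nu> = Pow (Pow {1..m})" by (simp add: \<nu>)
    fix k :: nat and \<A>
    assume inc: "increasing_family m \<A>"
      and pos: "0 < \<P>(Z in \<nu>. card Z = k)" "0 < \<P>(Z in \<nu>. card Z = k + 1)"
    (* Intersecting with \<open>{1..m}\<close> extends the indicator of \<open>\<A>\<close> monotonically to all sets. *)
    define g where "g S = (of_bool (S \<inter> {1..m} \<in> \<A>) :: real)" for S
    have "mono g"
    proof (rule monoI)
      fix S T :: "nat set" assume "S \<subseteq> T"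
      then have "T \<inter> {1..m} \<in> \<A>" if "S \<inter> {1..m} \<in> \<A>"
        using inc that unfolding increasing_family_def
        by (meson Int_lower2 Int_mono order_refl)
      then show "g S \<le> g T" by (auto simp: g_def)
    qed
    have le: "mass k g * mass (k + 1) (\<lambda>_. 1) \<le> mass (k + 1) g * mass k (\<lambda>_. 1)"
      unfolding mass_def using I(1) \<open>d < n\<close> _ \<open>mono g\<close>
      by (rule weighted_urn_NMP) (simp add: p_def)
    have size: "\<P>(Z in \<nu>. card Z = k) = mass k (\<lambda>_. 1) / prob Q" for k
      using \<nu>_prob[of "\<lambda>_. True" k] by simp
    have "{i \<in> I. f i = n} \<inter> {1..m} = {i \<in> I. f i = n}" for f
      by (auto simp: I_def)
    then have "mass k (\<lambda>Z. of_bool (Z \<in> \<A>)) = mass k g" for k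
      by (simp add: mass_def g_def)
    then have cond: "\<P>(Z in \<nu>. Z \<in> \<A> \<bar> card Z = k) = mass k g / mass k (\<lambda>_. 1)" for k
      using \<nu>_prob[of "\<lambda>Z. Z \<in> \<A>" k] size[of k] \<open>0 < prob Q\<close> by (simp add: cond_prob_def)
    have "0 < mass k (\<lambda>_. 1)" "0 < mass (k + 1) (\<lambda>_. 1)"
      using pos \<open>0 < prob Q\<close> unfolding size by (simp_all add: zero_less_divide_iff)
    then show "\<P>(Z in \<nu>. Z \<in> \<A> \<bar> card Z = k) \<le> \<P>(Z in \<nu>. Z \<in> \<A> \<bar> card Z = k + 1)"
      unfolding cond using le by (simp add: divide_simps mult.commute)
  qed
qed

end
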